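(* For every real $a>0$, $$S(a)=a\,S\left(\frac1a\right)+\frac{\ln(2\pi)-\gamma}{2}(1-a)+\frac{a+1}{2}\ln a.$$
   Context: Let $\psi(u)=\frac{d\ln\Gamma(u)}{du}$ be the digamma function and let $\gamma$ be the Euler-Mascheroni constant. For real $a>0$ define $$S(a)=\sum_{n=1}^\infty\left[\ln\frac{n}{a}-\frac{a}{2n}-\psi\left(\frac{n}{a}\right)\right].$$ *)

theory Defs
  imports "HOL-Analysis.Analysis"
begin

definition S_term :: "real \<Rightarrow> nat \<Rightarrow> real" where
  "S_term a n = ln (real n / a) - a / (2 * real n) - Digamma (real n / a)"

text \<open>The sum over n \<open>\<ge>\<close> 1, reindexed to start at 0.\<close>
definition S :: "real \<Rightarrow> real" where
  "S a = (\<Sum>n. S_term a (Suc n))"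

lemma digamma_remainder_bounds:
  fixes x :: real
  assumes x: "x > 0"
  shows "0 \<le> ln x - 1 / (2 * x) - Digamma x"
    and "ln x - 1 / (2 * x) - Digamma x \<le> 1 / (2 * x\<^sup>2)"
proof -
  define f where "f y = ln y - 1 / (2 * y) - Digamma y" for y :: real
  have step: "0 \<le> f y - f (y + 1) \<and> f y - f (y + 1) \<le> 1 / (2 * y\<^sup>2) - 1 / (2 * (y + 1)\<^sup>2)"
    if y: "y > 0" for y :: real
  proof -
    have "Digamma (y + 1) = Digamma y + 1 / y"
      using y by (intro Digamma_plus1) simp
    moreover have "1 / y - 1 / (2 * y) + 1 / (2 * (y + 1)) = (inverse y + inverse (y + 1)) / 2"
      using y by (simp add: inverse_eq_divide add_divide_distrib mult.commute)
    ultimately have eq: "f y - f (y + 1) = (inverse y + inverse (y + 1)) / 2 - (ln (y + 1) - ln y)"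
      by (simp add: f_def)
    have "ln (y + 1) - ln y \<le> (inverse y + inverse (y + 1)) / 2"
      using ln_inverse_approx_le[of y 1] y by simp
    moreover have "ln (y + 1) - ln y \<ge> 2 / (2 * y + 1)"
      using ln_inverse_approx_ge[of y "y + 1"] y by (simp add: add_ac)
    moreover have "(inverse y + inverse (y + 1)) / 2 - 2 / (2 * y + 1)
                     \<le> 1 / (2 * y\<^sup>2) - 1 / (2 * (y + 1)\<^sup>2)"
    proof -
      have "y * (y + 1) > 0"
        using y by simp
      moreover have "y * (y + 1) \<le> (2 * y + 1) * (2 * y + 1)"
        using y by (simp add: algebra_simps)
      ultimately have le: "1 / (2 * y + 1) \<le> (2 * y + 1) / (y * (y + 1))"
        using y by (simp add: pos_le_divide_eq pos_divide_le_eq)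
      have "(inverse y + inverse (y + 1)) / 2 - 2 / (2 * y + 1)
              = 1 / (2 * (y * (y + 1))) * (1 / (2 * y + 1))"
        using y by (simp add: divide_simps) (simp add: algebra_simps power2_eq_square)
      also have "\<dots> \<le> 1 / (2 * (y * (y + 1))) * ((2 * y + 1) / (y * (y + 1)))"
        using y le by (intro mult_left_mono) auto
      also have "\<dots> = 1 / (2 * y\<^sup>2) - 1 / (2 * (y + 1)\<^sup>2)"
        using y by (simp add: divide_simps power2_eq_square) (simp add: algebra_simps)
      finally show ?thesis .
    qed
    ultimately show ?thesis unfolding eq by linarith
  qed
  have bounds: "0 \<le> f x - f (x + real m) \<and> f x - f (x + real m) \<le> 1 / (2 * x\<^sup>2)" for m
  proof -
    have "0 \<le> f x - f (x + real m) \<and>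
          f x - f (x + real m) \<le> 1 / (2 * x\<^sup>2) - 1 / (2 * (x + real m)\<^sup>2)"
    proof (induction m)
      case (Suc m)
      have "x + real (Suc m) = (x + real m) + 1" by simp
      with Suc step[of "x + real m"] x show ?case by (smt (verit) of_nat_0_le_iff)
    qed simp
    moreover have "0 \<le> 1 / (2 * (x + real m)\<^sup>2)" by simp
    ultimately show ?thesis by linarith
  qed
  have lim: "(\<lambda>m. f (x + real m)) \<longlonglongrightarrow> 0"
  proof -
    have shift: "Digamma (x + real m) = Digamma x + (\<Sum>k<m. inverse (x + real k))" for m
    proof (induction m)
      case (Suc m)
      have "Digamma (x + real m + 1) = Digamma (x + real m) + 1 / (x + real m)"
        using x by (intro Digamma_plus1) (auto simp: add_nonneg_eq_0_iff)
      with Suc show ?case by (simp add: add_ac inverse_eq_divide)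
    qed simp
    have "(\<lambda>m. of_real (ln (real m)) - (\<Sum>n<m. inverse (x + of_nat n))) \<longlonglongrightarrow> Digamma x"
      using x by (intro Digamma_LIMSEQ) simp
    hence 1: "(\<lambda>m. ln (real m) - Digamma (x + real m)) \<longlonglongrightarrow> 0"
      by (simp add: shift LIM_zero_iff algebra_simps tendsto_diff flip: LIM_zero_iff[of _ "Digamma x"])
    have "(\<lambda>m. ln (1 + x / real m)) \<longlonglongrightarrow> ln (1 + 0)"
      by (intro tendsto_intros tendsto_divide_0[OF tendsto_const] filterlim_at_top_imp_at_infinity
            filterlim_real_sequentially) auto
    moreover have "eventually (\<lambda>m. ln (1 + x / real m) = ln (x + real m) - ln (real m)) sequentially"
      using eventually_gt_at_top[of 0]
    proof eventually_elim
      case (elim m)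
      hence "1 + x / real m = (x + real m) / real m" by (simp add: field_simps)
      with elim x show ?case by (simp add: ln_div)
    qed
    ultimately have 2: "(\<lambda>m. ln (x + real m) - ln (real m)) \<longlonglongrightarrow> 0"
      by (simp add: tendsto_cong)
    have 3: "(\<lambda>m. 1 / (2 * (x + real m))) \<longlonglongrightarrow> 0"
      by (intro tendsto_divide_0[OF tendsto_const] filterlim_at_top_imp_at_infinity
            filterlim_tendsto_pos_mult_at_top[OF tendsto_const]
            filterlim_tendsto_add_at_top[OF tendsto_const] filterlim_real_sequentially) auto
    from tendsto_diff[OF tendsto_add[OF 1 2] 3] show ?thesis
      by (simp add: f_def algebra_simps)
  qed
  have lim': "(\<lambda>m. f x - f (x + real m)) \<longlonglongrightarrow> f x"
    using tendsto_diff[OF tendsto_const lim, of "f x"] by simp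
  show "0 \<le> ln x - 1 / (2 * x) - Digamma x"
    using tendsto_lowerbound[OF lim', of 0] bounds by (auto simp: f_def)
  show "ln x - 1 / (2 * x) - Digamma x \<le> 1 / (2 * x\<^sup>2)"
    using tendsto_upperbound[OF lim', of "1 / (2 * x\<^sup>2)"] bounds by (auto simp: f_def)
qed

lemma summable_S_term:
  assumes "a > 0"
  shows "summable (\<lambda>n. S_term a (Suc n))"
proof (rule summable_comparison_test'[where N = 0])
  have "summable (\<lambda>n. inverse (real n ^ 2))"
    by (rule inverse_power_summable) simp
  hence "summable (\<lambda>n. inverse (real (Suc n) ^ 2))"
    by (subst summable_Suc_iff)
  thus "summable (\<lambda>n. a\<^sup>2 / 2 * inverse (real (Suc n) ^ 2))"
    by (rule summable_mult)
  fix n :: nat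
  show "norm (S_term a (Suc n)) \<le> a\<^sup>2 / 2 * inverse (real (Suc n) ^ 2)"
    using digamma_remainder_bounds[of "real (Suc n) / a"] assms
    by (simp add: S_term_def field_simps del: of_nat_Suc)
qed

end

(* Truncate S(a) and a S(1/a) at n = N and expand Digamma (n/a) down from Digamma (n/a + N + 1).
   Both sides then contain the same double sum of a / (n + m a) over 1 <= n, m <= N, which
   cancels. What remains is ln N!, the N-th harmonic number, and sums of Digamma over arithmetic
   progressions starting near N. The latter telescope, up to o(1), against an explicit primitive,
   so that the harmonic asymptotics and Stirling's formula give the constants. *)
theory Submission
  imports Defs "HOL-Real_Asymp.Real_Asymp"
begin

section \<open>Stirling's constant from the Wallis product\<close>

definition stirling_defect :: "nat \<Rightarrow> real" where
  "stirling_defect n = ln (fact n) - (real n + 1 / 2) * ln (real n) + real n"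

text \<open>The 1/2 in the factor n + 1/2 removes the 1/n term of the consecutive differences. They
  are O(1/n^2), so the telescoping series converges; its limit is found later.\<close>

lemma convergent_stirling_defect: "convergent stirling_defect"
proof -
  have "(\<lambda>n. 1 - (real n + 1 / 2) * ln (1 + 1 / real n)) \<in> O(\<lambda>n. 1 / real n ^ 2)"
    by real_asymp
  hence "summable (\<lambda>n. 1 - (real n + 1 / 2) * ln (1 + 1 / real n))"
    by (rule summable_comparison_test_bigo[rotated])
       (auto simp: norm_power norm_divide inverse_eq_divide[symmetric] intro!: inverse_power_summable)
  \<comment> \<open>Starting at index 1 keeps the default value of division by 0 out of the quotient
    (n + 1) / n.\<close>
  moreover have "stirling_defect (Suc (Suc n)) - stirling_defect (Suc n) =
      1 - (real (Suc n) + 1 / 2) * ln (1 + 1 / real (Suc n))" for n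
  proof -
    have "1 + 1 / real (Suc n) = real (Suc (Suc n)) / real (Suc n)"
      by (simp add: field_simps)
    hence ln_ratio: "ln (1 + 1 / real (Suc n)) = ln (real (Suc (Suc n))) - ln (real (Suc n))"
      by (simp add: ln_div del: of_nat_Suc)
    have ln_fact: "ln (fact (Suc (Suc n)) :: real) = ln (real (Suc (Suc n))) + ln (fact (Suc n))"
      by (subst fact_Suc, subst ln_mult) (auto simp del: fact_Suc)
    show ?thesis
      unfolding stirling_defect_def ln_ratio ln_fact by (simp add: algebra_simps del: fact_Suc)
  qed
  ultimately have "summable (\<lambda>n. stirling_defect (Suc (Suc n)) - stirling_defect (Suc n))"
    by (subst (asm) summable_Suc_iff[symmetric]) (simp only:)
  hence "convergent (\<lambda>n. stirling_defect (Suc n) - stirling_defect (Suc 0))"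
    unfolding summable_iff_convergent sum_lessThan_telescope[of "\<lambda>n. stirling_defect (Suc n)"] .
  hence "convergent (\<lambda>n. stirling_defect (Suc n))"
    using convergent_add[OF _ convergent_const[of "stirling_defect (Suc 0)"]] by fastforce
  thus ?thesis by (rule convergent_Suc_iff[THEN iffD1])
qed

text \<open>The factorials make the logarithm of the Wallis product comparable with
  \<open>4 * stirling_defect n - 2 * stirling_defect (2 * n)\<close>.\<close>

lemma wallis_prod_eq:
  "(\<Prod>k=1..n. (4 * real k ^ 2) / (4 * real k ^ 2 - 1)) =
     2 ^ (4 * n) * fact n ^ 4 / (fact (2 * n) ^ 2 * (2 * real n + 1))"
proof (induction n)
  case (Suc n)
  let ?w = "\<lambda>k. (4 * real k ^ 2) / (4 * real k ^ 2 - 1)"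
  \<comment> \<open>With \<open>p\<close>, \<open>f\<close>, \<open>g\<close> for the power of 2, n!
    and (2n)!, the induction step is an identity of rational functions.\<close>
  have *: "4 * (x + 1) ^ 2 / ((2 * x + 1) * (2 * x + 3)) * (p * f ^ 4 / (g ^ 2 * (2 * x + 1))) =
      16 * p * ((x + 1) * f) ^ 4 / ((2 * (x + 1) * (2 * x + 1) * g) ^ 2 * (2 * x + 3))"
    if "x \<ge> 0" "g > 0" for x p f g :: real
  proof -
    have "2 * x + 1 \<noteq> 0" "2 * x + 3 \<noteq> 0" "x + 1 \<noteq> 0" "g \<noteq> 0"
      using that by auto
    thus ?thesis
      by (simp add: divide_simps power_mult_distrib) algebra
  qed
  have "prod ?w {1..Suc n} = ?w (Suc n) * prod ?w {1..n}"
    by (rule prod.nat_ivl_Suc') simp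
  also have "?w (Suc n) = 4 * (real n + 1) ^ 2 / ((2 * real n + 1) * (2 * real n + 3))"
    by (intro arg_cong2[of _ _ _ _ "(/)"]) (simp_all add: algebra_simps power2_eq_square)
  also have "\<dots> * prod ?w {1..n} = 16 * 2 ^ (4 * n) * ((real n + 1) * fact n) ^ 4 /
      ((2 * (real n + 1) * (2 * real n + 1) * fact (2 * n)) ^ 2 * (2 * real n + 3))"
    unfolding Suc.IH by (rule *) simp_all
  also have "(real n + 1) * fact n = fact (Suc n)"
    by simp
  also have "2 * (real n + 1) * (2 * real n + 1) * fact (2 * n) = fact (2 * Suc n)"
    by (simp add: algebra_simps)
  also have "16 * 2 ^ (4 * n) = (2 :: real) ^ (4 * Suc n)"
    by (simp add: power_add)
  also have "2 * real n + 3 = 2 * real (Suc n) + 1"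
    by simp
  finally show ?case .
qed simp

text \<open>In 4 d(n) - 2 d(2n), with d the defect, the terms in n ln n and n cancel. What is left
  is the logarithm of the Wallis product plus ln (4n + 2) - ln n, so 2L = ln (pi/2) + ln 4.\<close>

lemma stirling_defect_LIMSEQ: "stirling_defect \<longlonglongrightarrow> ln (2 * pi) / 2"
proof -
  obtain L where L: "stirling_defect \<longlonglongrightarrow> L"
    using convergent_stirling_defect by (auto simp: convergent_def)
  have "(\<lambda>n. stirling_defect (2 * n)) \<longlonglongrightarrow> L"
    using LIMSEQ_subseq_LIMSEQ[OF L, of "\<lambda>n. 2 * n"] by (simp add: strict_mono_def o_def)
  hence double: "(\<lambda>n. 4 * stirling_defect n - 2 * stirling_defect (2 * n)) \<longlonglongrightarrow> 4 * L - 2 * L"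
    by (intro tendsto_intros L)
  have wallis_ln: "(\<lambda>n. ln (\<Prod>k=1..n. (4 * real k ^ 2) / (4 * real k ^ 2 - 1))) \<longlonglongrightarrow> ln (pi / 2)"
    by (intro tendsto_ln wallis) simp_all
  have ratio: "(\<lambda>n::nat. ln (4 * real n + 2) - ln (real n)) \<longlonglongrightarrow> ln 4"
    by real_asymp
  have "(\<lambda>n. 4 * stirling_defect n - 2 * stirling_defect (2 * n) 
      - (ln (\<Prod>k=1..n. (4 * real k ^ 2) / (4 * real k ^ 2 - 1))
         + (ln (4 * real n + 2) - ln (real n)))) \<longlonglongrightarrow> 4 * L - 2 * L - (ln (pi / 2) + ln 4)"
    by (rule tendsto_diff[OF double tendsto_add[OF wallis_ln ratio]])
  moreover have "\<forall>\<^sub>F n in sequentially. 4 * stirling_defect n - 2 * stirling_defect (2 * n) 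
      - (ln (\<Prod>k=1..n. (4 * real k ^ 2) / (4 * real k ^ 2 - 1))
         + (ln (4 * real n + 2) - ln (real n))) = 0"
    using eventually_gt_at_top[of 0]
  proof eventually_elim
    case (elim n)
    have "ln (4 * real n + 2) = ln 2 + ln (2 * real n + 1)"
      using ln_mult[of 2 "2 * real n + 1"] by simp
    moreover have "ln (real (2 * n)) = ln 2 + ln (real n)"
      using elim by (simp add: ln_mult)
    moreover have "ln (2 ^ (4 * n) * fact n ^ 4 / (fact (2 * n) ^ 2 * (2 * real n + 1)))
        = 4 * real n * ln 2 + 4 * ln (fact n) - (2 * ln (fact (2 * n)) + ln (2 * real n + 1))"
      using elim by (simp add: ln_div ln_mult ln_realpow add_pos_pos)
    ultimately show ?case
      unfolding stirling_defect_def wallis_prod_eq by (simp add: algebra_simps)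
  qed
  ultimately have "(\<lambda>_::nat. 0) \<longlonglongrightarrow> 4 * L - 2 * L - (ln (pi / 2) + ln 4)"
    by (simp only: tendsto_cong)
  hence "4 * L - 2 * L - (ln (pi / 2) + ln 4) = 0"
    by (simp add: LIMSEQ_const_iff)
  moreover have "ln (pi / 2) + ln 4 = ln (2 * pi)"
    using ln_mult[of "pi / 2" 4] by simp
  ultimately have "L = ln (2 * pi) / 2" by simp
  with L show ?thesis by simp
qed

section \<open>Digamma sums over arithmetic progressions\<close>

text \<open>Chosen so that the backward difference with step s matches s * Digamma (x + 1) up to O(1/x^2):
  as Digamma (x + 1) is ln x + 1 / (2 * x) + O(1/x^2), half of the coefficient of ln x comes from
  1 / (2 * x) and the part proportional to s compensates the second-order term of the difference.\<close>
definition digamma_primitive :: "real \<Rightarrow> real \<Rightarrow> real" where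
  "digamma_primitive s x = x * ln x - x + (1 + s) / 2 * ln x"

text \<open>\<open>digamma_remainder_bounds\<close> replaces Digamma x by ln x - 1/(2x) at cost
  O(1/x^2). The recurrence adds 1/x, and an elementary estimate for ln x + 1/(2x) remains.\<close>

lemma digamma_primitive_step_bigo:
  fixes s :: real
  assumes "s > 0"
  shows "(\<lambda>x. s * Digamma (x + 1) - (digamma_primitive s x - digamma_primitive s (x - s)))
           \<in> O(\<lambda>x. 1 / x ^ 2)"
proof -
  have "(\<lambda>x. s * (ln x - 1 / (2 * x) - Digamma x)) \<in> O(\<lambda>x. 1 / x ^ 2)"
  proof (intro bigoI[of _ "s / 2"] eventually_mono[OF eventually_gt_at_top[of 0]])
    fix x :: real
    assume "x > 0"
    hence "s * \<bar>ln x - 1 / (2 * x) - Digamma x\<bar> \<le> s * (1 / (2 * x\<^sup>2))"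
      using assms digamma_remainder_bounds[of x] by (intro mult_left_mono) auto
    thus "norm (s * (ln x - 1 / (2 * x) - Digamma x)) \<le> s / 2 * norm (1 / x\<^sup>2)"
      using assms by (simp add: abs_mult)
  qed
  moreover have "(\<lambda>x. s * (ln x + 1 / (2 * x)) - (digamma_primitive s x - digamma_primitive s (x - s)))
           \<in> O(\<lambda>x. 1 / x ^ 2)"
  proof -
    \<comment> \<open>The Taylor remainder of ln (1 - s/x) after second order, in the variable u =
      x/s so that its expansion is free of parameters.\<close>
    define L where "L x = ln (1 - 1 / (x / s)) + 1 / (x / s) + 1 / (2 * (x / s) ^ 2)" for x :: real
    have "(\<lambda>u::real. ln (1 - 1 / u) + 1 / u + 1 / (2 * u ^ 2)) \<in> O(\<lambda>u. 1 / u ^ 3)"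
      by real_asymp
    moreover have "filterlim (\<lambda>x. x / s) at_top at_top"
      using assms by real_asymp
    ultimately have "L \<in> O(\<lambda>x. 1 / (x / s) ^ 3)"
      unfolding L_def by (rule landau_o.big.compose)
    moreover have "(\<lambda>x. x + (1 - s) / 2) \<in> O(\<lambda>x. x)"
      by real_asymp
    ultimately have "(\<lambda>x. (x + (1 - s) / 2) * L x) \<in> O(\<lambda>x. x * (1 / (x / s) ^ 3))"
      by (rule landau_o.big.mult[rotated])
    also have "(\<lambda>x. x * (1 / (x / s) ^ 3)) \<in> O(\<lambda>x. 1 / x ^ 2)"
      using assms by real_asymp
    \<comment> \<open>Expressed through \<open>L\<close>, the constant and 1/x terms of the
      difference cancel. The subtracted multiple of 1/x^2 is the only other term left.\<close>
    finally have "(\<lambda>x. (x + (1 - s) / 2) * L x - (1 - s) / 4 * s ^ 2 / x ^ 2) \<in> O(\<lambda>x. 1 / x ^ 2)"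
      by (rule sum_in_bigo(2)) real_asymp
    also have "?this \<longleftrightarrow> ?thesis"
    proof (intro landau_o.big.in_cong eventually_mono[OF eventually_gt_at_top[of s]])
      fix x :: real
      assume x: "x > s"
      have "x - s = x * (1 - 1 / (x / s))" "1 - 1 / (x / s) > 0"
        using x assms by (simp_all add: field_simps)
      hence "ln (x - s) = ln x + ln (1 - 1 / (x / s))"
        using x assms by (simp add: ln_mult)
      then obtain m where m: "ln (x - s) = ln x + m" "L x = m + 1 / (x / s) + 1 / (2 * (x / s) ^ 2)"
        by (simp add: L_def)
      show "(x + (1 - s) / 2) * L x - (1 - s) / 4 * s ^ 2 / x ^ 2 =
          s * (ln x + 1 / (2 * x)) - (digamma_primitive s x - digamma_primitive s (x - s))"
        unfolding digamma_primitive_def m using x assms by (simp add: field_simps power2_eq_square)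
    qed
    finally show ?thesis .
  qed
  ultimately have "(\<lambda>x. s * (ln x + 1 / (2 * x)) - (digamma_primitive s x - digamma_primitive s (x - s))
      - s * (ln x - 1 / (2 * x) - Digamma x)) \<in> O(\<lambda>x. 1 / x ^ 2)"
    by (rule sum_in_bigo(2)[rotated])
  also have "?this \<longleftrightarrow> ?thesis"
    by (intro landau_o.big.in_cong eventually_mono[OF eventually_gt_at_top[of 0]])
       (simp add: Digamma_plus1 field_simps)
  finally show ?thesis .
qed

text \<open>The primitive telescopes along the progression. There are N error terms, each at an
  argument at least N and hence O(1/N^2), so the total error is O(1/N).\<close>

lemma sum_digamma_progression_LIMSEQ:
  fixes s :: real
  assumes s: "s > 0"
  shows "(\<lambda>N. (\<Sum>k=1..N. s * Digamma (real k * s + real N + 1))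
      - (digamma_primitive s (real N * s + real N) - digamma_primitive s (real N))) \<longlonglongrightarrow> 0"
proof -
  define e where "e x = s * Digamma (x + 1) - (digamma_primitive s x - digamma_primitive s (x - s))" for x
  have "e \<in> O(\<lambda>x. 1 / x ^ 2)"
    unfolding e_def using digamma_primitive_step_bigo[OF s] by (simp only:)
  then obtain C where C: "C > 0" "\<forall>\<^sub>F x in at_top. norm (e x) \<le> C * norm (1 / x ^ 2)"
    by (rule landau_o.bigE)
  then obtain X where X: "\<And>x. x \<ge> X \<Longrightarrow> \<bar>e x\<bar> \<le> C / x ^ 2"
    by (auto simp: eventually_at_top_linorder)
  have eq: "(\<Sum>k=1..N. s * Digamma (real k * s + real N + 1))
      - (digamma_primitive s (real N * s + real N) - digamma_primitive s (real N)) =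
      (\<Sum>k=1..N. e (real k * s + real N))" for N
  proof -
    let ?g = "\<lambda>k. digamma_primitive s (real k * s + real N)"
    have "(\<Sum>k=1..N. ?g k - ?g (k - 1)) = ?g N - ?g 0"
      using sum_telescope''[of 0 N ?g] by (simp add: atLeastSucAtMost_greaterThanAtMost)
    moreover have "e (real k * s + real N) = s * Digamma (real k * s + real N + 1) - (?g k - ?g (k - 1))"
      if "k \<in> {1..N}" for k
      using that by (simp add: e_def of_nat_diff algebra_simps)
    ultimately show ?thesis by (simp add: sum_subtractf)
  qed
  have "\<forall>\<^sub>F N in sequentially. norm (\<Sum>k=1..N. e (real k * s + real N)) \<le> C / real N"
    using eventually_ge_at_top[of "nat \<lceil>X\<rceil>"] eventually_gt_at_top[of 0]
  proof eventually_elim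
    case (elim N)
    have "\<bar>e (real k * s + real N)\<bar> \<le> C / real N ^ 2" for k
    proof -
      have le: "real N \<le> real k * s + real N" using s by simp
      moreover have "X \<le> real N" using elim by linarith
      ultimately have "\<bar>e (real k * s + real N)\<bar> \<le> C / (real k * s + real N) ^ 2"
        by (intro X) linarith
      also have "\<dots> \<le> C / real N ^ 2"
        using le elim C by (intro divide_left_mono power_mono mult_pos_pos zero_less_power) auto
      finally show ?thesis .
    qed
    hence "norm (\<Sum>k=1..N. e (real k * s + real N)) \<le> (\<Sum>k=1..N. C / real N ^ 2)"
      by (intro sum_norm_le) simp
    thus ?case using elim by (simp add: power2_eq_square)
  qed
  moreover have "(\<lambda>N. C / real N) \<longlonglongrightarrow> 0" by real_asymp
  ultimately show ?thesis unfolding eq by (rule Lim_null_comparison)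
qed

section \<open>Truncated sums and the symmetric double sum\<close>

text \<open>The term 1/x is kept apart so that m starts at 1, as the symmetry of the double sum in n
  and m requires.\<close>

lemma Digamma_plus_of_nat:
  fixes x :: real
  assumes "x > 0"
  shows "Digamma (x + real N + 1) = Digamma x + 1 / x + (\<Sum>m=1..N. 1 / (x + real m))"
proof (induction N)
  case 0
  show ?case using assms by (simp add: Digamma_plus1)
next
  case (Suc N)
  have "Digamma (x + real (Suc N) + 1) = Digamma (x + real (Suc N)) + 1 / (x + real (Suc N))"
    using assms by (intro Digamma_plus1) auto
  with Suc show ?case by (simp add: add_ac)
qed

lemma ln_fact_eq_sum: "ln (fact N :: real) = (\<Sum>n=1..N. ln (real n))"
  by (simp add: fact_prod, subst ln_prod) auto

text \<open>The a/n split off from Digamma turns -a/(2n) into +a/(2n), whence the harmonic number.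
  The factors a and 1/a stay uncancelled to match the progression sum with step s = 1/a.\<close>

lemma sum_S_term:
  fixes a :: real
  assumes a: "a > 0"
  shows "(\<Sum>n=1..N. S_term a n) = ln (fact N) - real N * ln a + a / 2 * harm N
     - a * (\<Sum>n=1..N. 1 / a * Digamma (real n * (1 / a) + real N + 1))
     + (\<Sum>n=1..N. \<Sum>m=1..N. a / (real n + real m * a))"
proof -
  have "S_term a n = ln (real n) - ln a + a / 2 * inverse (real n)
      - a * (1 / a * Digamma (real n * (1 / a) + real N + 1))
      + (\<Sum>m=1..N. a / (real n + real m * a))" if "n \<in> {1..N}" for n
  proof -
    have n: "real n > 0" using that by simp
    have "1 / (real n / a + real m) = a / (real n + real m * a)" for m
      using n a by (simp add: field_simps)
    hence "Digamma (real n / a + real N + 1) =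
        Digamma (real n / a) + a / real n + (\<Sum>m=1..N. a / (real n + real m * a))"
      using Digamma_plus_of_nat[of "real n / a" N] n a by simp
    thus ?thesis
      using n a by (simp add: S_term_def ln_div inverse_eq_divide)
  qed
  hence "(\<Sum>n=1..N. S_term a n) = (\<Sum>n=1..N. ln (real n) - ln a + a / 2 * inverse (real n)
      - a * (1 / a * Digamma (real n * (1 / a) + real N + 1))
      + (\<Sum>m=1..N. a / (real n + real m * a)))"
    by (intro sum.cong) auto
  thus ?thesis
    by (simp only: sum.distrib sum_subtractf sum_distrib_left[symmetric] ln_fact_eq_sum harm_def)
       simp
qed

lemma sum_S_term_diff:
  fixes a :: real
  assumes a: "a > 0"
  shows "(\<Sum>n=1..N. S_term a n) - a * (\<Sum>n=1..N. S_term (1 / a) n) =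
     (1 - a) * ln (fact N) - (1 + a) * real N * ln a - (1 - a) / 2 * harm N
     - a * (\<Sum>n=1..N. 1 / a * Digamma (real n * (1 / a) + real N + 1))
     + (\<Sum>n=1..N. a * Digamma (real n * a + real N + 1))"
proof -
  \<comment> \<open>Multiplication by a turns the summand for 1/a into that for a with n and m
    exchanged.\<close>
  have "a * (\<Sum>n=1..N. \<Sum>m=1..N. (1 / a) / (real n + real m * (1 / a))) =
        (\<Sum>n=1..N. \<Sum>m=1..N. a / (real m + real n * a))"
    using a by (simp add: sum_distrib_left field_simps)
  also have "\<dots> = (\<Sum>n=1..N. \<Sum>m=1..N. a / (real n + real m * a))"
    by (rule sum.swap)
  finally have double_sum: "a * (\<Sum>n=1..N. \<Sum>m=1..N. (1 / a) / (real n + real m * (1 / a))) =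
        (\<Sum>n=1..N. \<Sum>m=1..N. a / (real n + real m * a))" .
  have "a * (\<Sum>n=1..N. S_term (1 / a) n) = a * ln (fact N) + a * real N * ln a + 1 / 2 * harm N
      - (\<Sum>n=1..N. a * Digamma (real n * a + real N + 1))
      + a * (\<Sum>n=1..N. \<Sum>m=1..N. (1 / a) / (real n + real m * (1 / a)))"
    using a by (subst sum_S_term) (simp_all add: ln_div algebra_simps sum_distrib_left)
  thus ?thesis
    unfolding double_sum sum_S_term[OF a] by (simp add: algebra_simps add_divide_distrib diff_divide_distrib)
qed

lemma sum_S_term_LIMSEQ:
  assumes "a > 0"
  shows "(\<lambda>N. \<Sum>n=1..N. S_term a n) \<longlonglongrightarrow> S a"
  using summable_LIMSEQ[OF summable_S_term[OF assms]]
  by (simp add: S_def sum.atLeast1_atMost_eq)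

section \<open>Passage to the limit\<close>

theorem mainTheorem2:
  fixes a :: real
  assumes "a > 0"
  shows "S a = a * S (1 / a) + (ln (2 * pi) - euler_mascheroni) / 2 * (1 - a) + (a + 1) / 2 * ln a"
proof -
  define R where "R s N = (\<Sum>k=1..N. s * Digamma (real k * s + real N + 1))
      - (digamma_primitive s (real N * s + real N) - digamma_primitive s (real N))" for s N
  define D where "D N = (\<Sum>n=1..N. S_term a n) - a * (\<Sum>n=1..N. S_term (1 / a) n)" for N
  \<comment> \<open>Every divergent contribution is absorbed: the (1/2) ln N left between ln N! and
    the defect is exactly what the harmonic number needs.\<close>
  have D_eq: "D N = (1 - a) * stirling_defect N - (1 - a) / 2 * (harm N - ln (real N))
      - a * R (1 / a) N + R a N + (a + 1) / 2 * ln a" if "N > 0" for N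
  proof -
    \<comment> \<open>The progressions with steps a and 1/a end at b and b/a. Hence ln b cancels
      between the two primitives, and the remaining b ln a cancels (1 + a) N ln a.\<close>
    define b where "b = real N * a + real N"
    have b: "b > 0" using that assms by (simp add: b_def add_pos_pos)
    have "real N * (1 / a) + real N = b / a"
      using assms by (simp add: b_def field_simps)
    moreover have "a * digamma_primitive (1 / a) (b / a) =
        b * (ln b - ln a) - b + (a + 1) / 2 * (ln b - ln a)"
      using assms b by (simp add: digamma_primitive_def ln_div field_simps)
    moreover have "digamma_primitive a b = b * ln b - b + (a + 1) / 2 * ln b"
      by (simp add: digamma_primitive_def)
    \<comment> \<open>At the common starting point N the bare ln N terms agree, both with
      coefficient (a + 1)/2.\<close>
    moreover have "a * digamma_primitive (1 / a) (real N) - digamma_primitive a (real N) =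
        (a - 1) * (real N * ln (real N) - real N)"
      using assms by (simp add: digamma_primitive_def field_simps)
    ultimately have "a * (digamma_primitive (1 / a) (real N * (1 / a) + real N) - digamma_primitive (1 / a) (real N))
       - (digamma_primitive a b - digamma_primitive a (real N)) =
       - (b + (a + 1) / 2) * ln a + (1 - a) * (real N * ln (real N) - real N)"
      by (simp add: algebra_simps) (simp add: field_simps)
    thus ?thesis
      unfolding D_def sum_S_term_diff[OF assms] R_def stirling_defect_def b_def
      by (simp add: algebra_simps add_divide_distrib diff_divide_distrib)
  qed
  have R: "R s \<longlonglongrightarrow> 0" if "s > 0" for s
    unfolding R_def by (rule sum_digamma_progression_LIMSEQ[OF that])
  have "D \<longlonglongrightarrow> S a - a * S (1 / a)"
    unfolding D_def using assms by (intro tendsto_intros sum_S_term_LIMSEQ) auto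
  moreover have "D \<longlonglongrightarrow> (1 - a) * (ln (2 * pi) / 2) - (1 - a) / 2 * euler_mascheroni
      - a * 0 + 0 + (a + 1) / 2 * ln a"
  proof (rule Lim_transform_eventually)
    show "(\<lambda>N. (1 - a) * stirling_defect N - (1 - a) / 2 * (harm N - ln (real N))
      - a * R (1 / a) N + R a N + (a + 1) / 2 * ln a) \<longlonglongrightarrow>
      (1 - a) * (ln (2 * pi) / 2) - (1 - a) / 2 * euler_mascheroni - a * 0 + 0 + (a + 1) / 2 * ln a"
      using assms by (intro tendsto_intros stirling_defect_LIMSEQ R euler_mascheroni_LIMSEQ) auto
    show "\<forall>\<^sub>F N in sequentially. (1 - a) * stirling_defect N - (1 - a) / 2 * (harm N - ln (real N))
      - a * R (1 / a) N + R a N + (a + 1) / 2 * ln a = D N"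
      by (intro eventually_mono[OF eventually_gt_at_top[of 0]] D_eq[symmetric])
  qed
  ultimately have "S a - a * S (1 / a) = (1 - a) * (ln (2 * pi) / 2) - (1 - a) / 2 * euler_mascheroni
      - a * 0 + 0 + (a + 1) / 2 * ln a"
    by (rule LIMSEQ_unique)
  thus ?thesis by (simp add: field_simps)
qed

end
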